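(* Let $\rho$ be a metric on $V$. Then the transportation-information inequality $$W_{1,\rho}^2(\nu,\mu)\le 2c_{\rm G}\,I(\nu|\mu)\qquad\text{for all probability measures }\nu\text{ on }V$$ holds with best constant $$c_{\rm G}\le K:=\inf_w K(w),$$ where the infimum is taken over all length functions $w$ on $E$ and $$K(w)=\max_{\mathbf{e}\in E}\frac{1}{Q(\mathbf{e})w(\mathbf{e})}\sum_{x,y\in V}\mathbb{E}^\gamma\,1_{\gamma_{xy}}(\mathbf{e})\,\rho^2(x,y)\,|\gamma_{xy}|_w\,\mu(x)\mu(y).$$
   Context: Setting: $G=(V,E)$ is a finite connected graph with vertex set $V$ and set of oriented edges $E\subset V^2\setminus\{(x,x):x\in V\}$, which is symmetric; $x\sim y$ means $(x,y)\in E$. Jump rates $q(x,y)\ge 0$ are given with $q(x,y)>0$ if and only if $x\sim y$. A probability measure $\mu$ on $V$ satisfies the detailed balance condition $Q(x,y):=\mu(x)q(x,y)=\mu(y)q(y,x)$ for all $(x,y)\in E$. For $\mathbf{e}=(x,y)\in E$ write $Q(\mathbf{e})=Q(x,y)$ and $D_{\mathbf{e}}h=h(y)-h(x)$. $W_{1,\rho}(\nu,\mu)=\inf_\pi\sum_{x,y}\rho(x,y)\pi(x,y)$ over couplings $\pi$ of $(\nu,\mu)$. For a probability measure $\nu=h^2\mu$ (with $h\ge 0$ the square root of the density), $I(\nu|\mu)=\frac12\sum_{\mathbf{e}\in E}(D_{\mathbf{e}}h)^2Q(\mathbf{e})$. $c_{\rm G}$ denotes the best (smallest) constant in the displayed transportation-information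 inequality for the metric $\rho$. A path $\gamma_{xy}$ from $x$ to $y$ is a family of edges $\{\mathbf{e}_1,\dots,\mathbf{e}_n\}$ with $\mathbf{e}_k=(x_{k-1},x_k)\in E$, $x_0=x$, $x_n=y$; it has no circle if all $x_0,\dots,x_n$ are different. A length function is a function $w:E\to(0,\infty)$ with $w(x,y)=w(y,x)$; $|\gamma_{xy}|_w=\sum_{\mathbf{e}\in\gamma_{xy}}w(\mathbf{e})$. For every $x\ne y$ in $V$, $\gamma_{xy}$ is a given random (possibly deterministic) path without circle from $x$ to $y$; $\gamma_{xx}=\emptyset$. $\mathbb{E}^\gamma$ is the expectation with respect to the random family $\{\gamma_{xy}:x,y\in V\}$, and $1_{\gamma_{xy}}(\mathbf{e})=1$ if $\mathbf{e}\in\gamma_{xy}$ and $0$ otherwise. *)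

theory Defs
  imports
    "HOL-Probability.Probability"
    "Graph_Theory.Digraph_Component"
begin

(* Graphs are pair digraphs of the AFP entry Graph_Theory satisfying pair_graph: finite, symmetric,
   without loops, with oriented edges parcs G. Probability measures on the vertex set pverts G are
   pmfs supported in pverts G. *)

definition conductance :: "('a \<Rightarrow> 'a \<Rightarrow> real) \<Rightarrow> 'a pmf \<Rightarrow> 'a \<times> 'a \<Rightarrow> real" where
  "conductance q \<mu> e = pmf \<mu> (fst e) * q (fst e) (snd e)"

definition diff_along :: "'a \<times> 'a \<Rightarrow> ('a \<Rightarrow> real) \<Rightarrow> real" where
  "diff_along e h = h (snd e) - h (fst e)"

(* The two conditions on q are required on all of pverts G; since the graph has no loops,
   they force q to vanish on the diagonal. *)
definition jump_rates :: "'a pair_pre_digraph \<Rightarrow> ('a \<Rightarrow> 'a \<Rightarrow> real) \<Rightarrow> bool" where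
  "jump_rates G q \<longleftrightarrow>
     (\<forall>x\<in>pverts G. \<forall>y\<in>pverts G. 0 \<le> q x y \<and> (0 < q x y \<longleftrightarrow> (x, y) \<in> parcs G))"

definition detailed_balance ::
    "'a pair_pre_digraph \<Rightarrow> ('a \<Rightarrow> 'a \<Rightarrow> real) \<Rightarrow> 'a pmf \<Rightarrow> bool" where
  "detailed_balance G q \<mu> \<longleftrightarrow>
     (\<forall>(x, y)\<in>parcs G. pmf \<mu> x * q x y = pmf \<mu> y * q y x)"

definition couplings :: "'a pmf \<Rightarrow> 'a pmf \<Rightarrow> ('a \<times> 'a) pmf set" where
  "couplings \<nu> \<mu> = {\<pi>. map_pmf fst \<pi> = \<nu> \<and> map_pmf snd \<pi> = \<mu>}"

definition W1 :: "'a pair_pre_digraph \<Rightarrow> ('a \<Rightarrow> 'a \<Rightarrow> real) \<Rightarrow> 'a pmf \<Rightarrow> 'a pmf \<Rightarrow> real" where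
  "W1 G \<rho> \<nu> \<mu> =
     (INF \<pi>\<in>couplings \<nu> \<mu>. \<Sum>x\<in>pverts G. \<Sum>y\<in>pverts G. \<rho> x y * pmf \<pi> (x, y))"

(* Connectedness, positivity of q on edges and detailed balance force pmf \<mu> x > 0 at every
   vertex, so that every \<nu> has a density and the division is a genuine one. *)
definition sqrt_density :: "'a pmf \<Rightarrow> 'a pmf \<Rightarrow> 'a \<Rightarrow> real" where
  "sqrt_density \<nu> \<mu> x = sqrt (pmf \<nu> x / pmf \<mu> x)"

definition information ::
    "'a pair_pre_digraph \<Rightarrow> ('a \<Rightarrow> 'a \<Rightarrow> real) \<Rightarrow> 'a pmf \<Rightarrow> 'a pmf \<Rightarrow> real" where
  "information G q \<nu> \<mu> =
     1 / 2 * (\<Sum>e\<in>parcs G. (diff_along e (sqrt_density \<nu> \<mu>))\<^sup>2 * conductance q \<mu> e)"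

definition transport_information ::
    "'a pair_pre_digraph \<Rightarrow> ('a \<Rightarrow> 'a \<Rightarrow> real) \<Rightarrow> 'a pmf \<Rightarrow> ('a \<Rightarrow> 'a \<Rightarrow> real) \<Rightarrow> real \<Rightarrow> bool" where
  "transport_information G q \<mu> \<rho> c \<longleftrightarrow>
     (\<forall>\<nu>. set_pmf \<nu> \<subseteq> pverts G \<longrightarrow> (W1 G \<rho> \<nu> \<mu>)\<^sup>2 \<le> 2 * c * information G q \<nu> \<mu>)"

(* The requirement 0 \<le> c is automatic as soon as there are two vertices; for a single vertex, where
   both sides of the inequality vanish, it makes the best constant 0. *)
definition c_G ::
    "'a pair_pre_digraph \<Rightarrow> ('a \<Rightarrow> 'a \<Rightarrow> real) \<Rightarrow> 'a pmf \<Rightarrow> ('a \<Rightarrow> 'a \<Rightarrow> real) \<Rightarrow> real" where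
  "c_G G q \<mu> \<rho> = Inf {c. 0 \<le> c \<and> transport_information G q \<mu> \<rho> c}"

(* Only the values on parcs G matter. *)
definition length_functions :: "'a pair_pre_digraph \<Rightarrow> ('a \<times> 'a \<Rightarrow> real) set" where
  "length_functions G = {w. \<forall>(x, y)\<in>parcs G. 0 < w (x, y) \<and> w (x, y) = w (y, x)}"

definition path_length :: "('a \<times> 'a \<Rightarrow> real) \<Rightarrow> ('a \<times> 'a) awalk \<Rightarrow> real" where
  "path_length w p = (\<Sum>e\<in>set p. w e)"

(* A random family of paths without circle, on the probability space P: a path is the list of its
   edges, and apath requires all visited vertices to be distinct. Paths carry the discrete
   sigma-algebra. The vertex set being finite, measurability of each path amounts to
   measurability of the whole family. *)
definition random_paths ::
    "'a pair_pre_digraph \<Rightarrow> 'w measure \<Rightarrow> ('a \<Rightarrow> 'a \<Rightarrow> 'w \<Rightarrow> ('a \<times> 'a) awalk) \<Rightarrow> bool" where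
  "random_paths G P \<gamma> \<longleftrightarrow> prob_space P \<and>
     (\<forall>x\<in>pverts G. \<forall>y\<in>pverts G.
        \<gamma> x y \<in> measurable P (count_space UNIV) \<and>
        (\<forall>\<omega>\<in>space P. if x = y then \<gamma> x y \<omega> = []
                      else pre_digraph.apath (with_proj G) x (\<gamma> x y \<omega>) y))"

definition edge_load ::
    "'a pair_pre_digraph \<Rightarrow> ('a \<Rightarrow> 'a \<Rightarrow> real) \<Rightarrow> 'a pmf \<Rightarrow> ('a \<Rightarrow> 'a \<Rightarrow> real) \<Rightarrow> 'w measure \<Rightarrow>
     ('a \<Rightarrow> 'a \<Rightarrow> 'w \<Rightarrow> ('a \<times> 'a) awalk) \<Rightarrow> ('a \<times> 'a \<Rightarrow> real) \<Rightarrow> 'a \<times> 'a \<Rightarrow> real" where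
  "edge_load G q \<mu> \<rho> P \<gamma> w e =
     1 / (conductance q \<mu> e * w e) *
     (\<Sum>x\<in>pverts G. \<Sum>y\<in>pverts G.
        prob_space.expectation P
          (\<lambda>\<omega>. indicator (set (\<gamma> x y \<omega>)) e * (\<rho> x y)\<^sup>2 * path_length w (\<gamma> x y \<omega>)
                 * pmf \<mu> x * pmf \<mu> y))"

(* A graph with a single vertex has no edges; the maximum over the empty set is read as 0. *)
definition K_len ::
    "'a pair_pre_digraph \<Rightarrow> ('a \<Rightarrow> 'a \<Rightarrow> real) \<Rightarrow> 'a pmf \<Rightarrow> ('a \<Rightarrow> 'a \<Rightarrow> real) \<Rightarrow> 'w measure \<Rightarrow>
     ('a \<Rightarrow> 'a \<Rightarrow> 'w \<Rightarrow> ('a \<times> 'a) awalk) \<Rightarrow> ('a \<times> 'a \<Rightarrow> real) \<Rightarrow> real" where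
  "K_len G q \<mu> \<rho> P \<gamma> w =
     (if parcs G = {} then 0 else (MAX e\<in>parcs G. edge_load G q \<mu> \<rho> P \<gamma> w e))"

definition K_inf ::
    "'a pair_pre_digraph \<Rightarrow> ('a \<Rightarrow> 'a \<Rightarrow> real) \<Rightarrow> 'a pmf \<Rightarrow> ('a \<Rightarrow> 'a \<Rightarrow> real) \<Rightarrow> 'w measure \<Rightarrow>
     ('a \<Rightarrow> 'a \<Rightarrow> 'w \<Rightarrow> ('a \<times> 'a) awalk) \<Rightarrow> real" where
  "K_inf G q \<mu> \<rho> P \<gamma> = (INF w\<in>length_functions G. K_len G q \<mu> \<rho> P \<gamma> w)"

end

theory Submission
  imports Defs
begin

text \<open>
  Write \<open>\<nu> = h\<^sup>2 \<mu>\<close> and fix a length function \<open>w\<close>. Everything reduces to the chain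
  \<open>W\<^sub>1(\<nu>,\<mu>)\<^sup>2 \<le> \<Sum>\<^sub>x\<^sub>,\<^sub>y \<rho>(x,y)\<^sup>2 (h(y) - h(x))\<^sup>2 \<mu>(x) \<mu>(y) \<le> 2 K(w) I(\<nu>|\<mu>)\<close>.

  The first inequality comes from an explicit coupling. Compare \<open>\<nu>\<close> and \<open>\<mu>\<close> through the product measure: for every pair \<open>(x, y)\<close> with
  \<open>h\<^sup>2(x) > h\<^sup>2(y)\<close>, send the mass \<open>(h\<^sup>2(x) - h\<^sup>2(y)) \<mu>(x) \<mu>(y)\<close> from \<open>x\<close> to \<open>y\<close>, and leave all other
  mass in place. The net outflow of \<open>x\<close> is
  \<open>\<Sum>\<^sub>y (h\<^sup>2(x) - h\<^sup>2(y)) \<mu>(x) \<mu>(y) = \<nu>(x) - \<mu>(x)\<close>, and its gross outflow is at most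
  \<open>h\<^sup>2(x) \<mu>(x) = \<nu>(x)\<close>, so this is a transport plan from \<open>\<nu>\<close> to \<open>\<mu>\<close> (lemma \<open>excess_coupling\<close>).
  Its cost is half the sum of \<open>\<rho>(x, y) \<bar>h(y) - h(x)\<bar> (h(x) + h(y)) \<mu>(x) \<mu>(y)\<close>, and the
  Cauchy-Schwarz inequality together with
  \<open>\<Sum>\<^sub>x\<^sub>,\<^sub>y (h(x) + h(y))\<^sup>2 \<mu>(x) \<mu>(y) \<le> 4\<close> gives the bound (lemma \<open>W1_sq_le_variation\<close>).

  For the second inequality, \<open>h(y) - h(x)\<close> is the sum of the increments of \<open>h\<close> along the random
  path from \<open>x\<close> to \<open>y\<close>. Cauchy-Schwarz with the weights \<open>w\<close> bounds its square by the length of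
  the path times the sum of \<open>(D\<^sub>e h)\<^sup>2 / w(e)\<close> over its edges. Averaging over the path, summing over
  \<open>x, y\<close> and exchanging the sums collects in front of each \<open>(D\<^sub>e h)\<^sup>2\<close> exactly \<open>Q(e)\<close> times the
  quantity maximised in \<open>K(w)\<close> (lemma \<open>variation_le_K_len\<close>).

  Hence every \<open>K(w)\<close> is an admissible constant. The best constant is itself admissible because, for
  each \<open>\<nu>\<close>, the inequality is a closed condition on the constant (lemma
  \<open>transport_information_c_G\<close>).
\<close>

section \<open>Couplings\<close>

lemma coupling_of_table:
  fixes t :: "'a \<Rightarrow> 'a \<Rightarrow> real"
  assumes fin: "finite V" and \<nu>: "set_pmf \<nu> \<subseteq> V" and \<mu>: "set_pmf \<mu> \<subseteq> V"
    and nonneg: "\<And>x y. 0 \<le> t x y"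
    and zero: "\<And>x y. x \<notin> V \<or> y \<notin> V \<Longrightarrow> t x y = 0"
    and rows: "\<And>x. x \<in> V \<Longrightarrow> (\<Sum>y\<in>V. t x y) = pmf \<nu> x"
    and cols: "\<And>y. y \<in> V \<Longrightarrow> (\<Sum>x\<in>V. t x y) = pmf \<mu> y"
  obtains \<pi> where "\<pi> \<in> couplings \<nu> \<mu>" "\<And>x y. pmf \<pi> (x, y) = t x y"
proof -
  define g where "g = (\<lambda>(x, y). t x y)"
  have g_nonneg: "0 \<le> g p" for p
    by (cases p) (simp add: g_def nonneg)
  have g_zero: "g p = 0" if "p \<notin> V \<times> V" for p
    using that zero by (cases p) (auto simp: g_def)
  have "(\<integral>\<^sup>+p. ennreal (g p) \<partial>count_space UNIV) = (\<Sum>p\<in>V \<times> V. ennreal (g p))"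
    by (rule nn_integral_count_space'[OF finite_cartesian_product[OF fin fin]])
      (simp_all only: g_zero ennreal_0 subset_UNIV not_False_eq_True)
  also have "\<dots> = ennreal (\<Sum>p\<in>V \<times> V. g p)"
    using g_nonneg by simp
  also have "(\<Sum>p\<in>V \<times> V. g p) = (\<Sum>x\<in>V. \<Sum>y\<in>V. t x y)"
    by (simp add: sum.cartesian_product g_def)
  also have "\<dots> = (\<Sum>x\<in>V. pmf \<nu> x)"
    using rows by simp
  also have "\<dots> = 1"
    by (rule sum_pmf_eq_1[OF fin \<nu>])
  finally have total: "(\<integral>\<^sup>+p. ennreal (g p) \<partial>count_space UNIV) = 1"
    by simp
  define \<pi> where "\<pi> = embed_pmf g"
  have pmf_\<pi>: "pmf \<pi> p = g p" for p
    unfolding \<pi>_def by (rule pmf_embed_pmf[OF g_nonneg total])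
  have supp: "set_pmf \<pi> \<subseteq> V \<times> V"
    using zero by (auto simp: set_pmf_eq pmf_\<pi> g_def)
  have "pmf (map_pmf fst \<pi>) x = pmf \<nu> x" for x
  proof (cases "x \<in> V")
    case True
    have "pmf (map_pmf fst \<pi>) x = measure \<pi> (fst -` {x} \<inter> set_pmf \<pi>)"
      by (simp add: pmf_map measure_Int_set_pmf)
    also have "fst -` {x} \<inter> set_pmf \<pi> = (Pair x ` V) \<inter> set_pmf \<pi>"
      using supp by auto
    also have "measure \<pi> \<dots> = (\<Sum>p\<in>Pair x ` V. pmf \<pi> p)"
      by (simp add: measure_Int_set_pmf measure_measure_pmf_finite fin)
    also have "\<dots> = (\<Sum>y\<in>V. t x y)"
      by (subst sum.reindex) (auto simp: inj_on_def pmf_\<pi> g_def)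
    finally show ?thesis
      using rows[OF True] by simp
  next
    case False
    then have "x \<notin> set_pmf (map_pmf fst \<pi>)" "x \<notin> set_pmf \<nu>"
      using supp \<nu> by auto
    then show ?thesis
      by (simp add: set_pmf_eq)
  qed
  moreover have "pmf (map_pmf snd \<pi>) y = pmf \<mu> y" for y
  proof (cases "y \<in> V")
    case True
    have "pmf (map_pmf snd \<pi>) y = measure \<pi> (snd -` {y} \<inter> set_pmf \<pi>)"
      by (simp add: pmf_map measure_Int_set_pmf)
    also have "snd -` {y} \<inter> set_pmf \<pi> = ((\<lambda>x. (x, y)) ` V) \<inter> set_pmf \<pi>"
      using supp by auto
    also have "measure \<pi> \<dots> = (\<Sum>p\<in>(\<lambda>x. (x, y)) ` V. pmf \<pi> p)"
      by (simp add: measure_Int_set_pmf measure_measure_pmf_finite fin)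
    also have "\<dots> = (\<Sum>x\<in>V. t x y)"
      by (subst sum.reindex) (auto simp: inj_on_def pmf_\<pi> g_def)
    finally show ?thesis
      using cols[OF True] by simp
  next
    case False
    then have "y \<notin> set_pmf (map_pmf snd \<pi>)" "y \<notin> set_pmf \<mu>"
      using supp \<mu> by auto
    then show ?thesis
      by (simp add: set_pmf_eq)
  qed
  ultimately have "\<pi> \<in> couplings \<nu> \<mu>"
    by (simp add: couplings_def pmf_eqI)
  then show thesis
    using that pmf_\<pi> by (simp add: g_def)
qed

text \<open>
  With \<open>f\<close> the density of \<open>\<nu>\<close>, the off-diagonal entries move the positive part of
  \<open>f x - f y\<close>. What stays at \<open>x\<close> is \<open>\<Sum>\<^sub>z \<mu>(x) \<mu>(z) min (f x) (f z)\<close>: this is non-negative, and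
  both marginals come out right because \<open>max 0 (a - b) + min a b = a\<close>.
\<close>

lemma excess_coupling:
  fixes \<mu> \<nu> :: "'a pmf"
  assumes fin: "finite (set_pmf \<mu>)" and ac: "set_pmf \<nu> \<subseteq> set_pmf \<mu>"
  defines "f \<equiv> \<lambda>x. pmf \<nu> x / pmf \<mu> x"
  obtains \<pi> where "\<pi> \<in> couplings \<nu> \<mu>"
    "\<And>x y. x \<noteq> y \<Longrightarrow> pmf \<pi> (x, y) = pmf \<mu> x * pmf \<mu> y * max 0 (f x - f y)"
proof -
  let ?V = "set_pmf \<mu>"
  have f_nonneg: "0 \<le> f x" for x
    by (simp add: f_def)
  have \<mu>f: "pmf \<mu> x * f x = pmf \<nu> x" for x
    using ac by (cases "x \<in> ?V") (auto simp: f_def set_pmf_eq)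
  define s where "s x = (\<Sum>z\<in>?V. pmf \<mu> x * pmf \<mu> z * min (f x) (f z))" for x
  define m where "m x y = pmf \<mu> x * pmf \<mu> y * max 0 (f x - f y)" for x y
  define t where "t x y = m x y + (if x = y then s x else 0)" for x y
  have sum\<mu>: "(\<Sum>x\<in>?V. pmf \<mu> x) = 1" and sum\<nu>: "(\<Sum>x\<in>?V. pmf \<nu> x) = 1"
    using sum_pmf_eq_1[OF fin ac] sum_pmf_eq_1[OF fin order_refl] by auto
  have s_nonneg: "0 \<le> s x" for x
    unfolding s_def by (intro sum_nonneg mult_nonneg_nonneg) (auto simp: f_nonneg)
  obtain \<pi> where \<pi>: "\<pi> \<in> couplings \<nu> \<mu>" "\<And>x y. pmf \<pi> (x, y) = t x y"
  proof (rule coupling_of_table[OF fin ac order_refl, of t])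
    show "0 \<le> t x y" for x y
      by (simp add: t_def m_def s_nonneg)
    show "t x y = 0" if "x \<notin> ?V \<or> y \<notin> ?V" for x y
      using that by (auto simp: t_def m_def s_def set_pmf_eq)
    show "(\<Sum>y\<in>?V. t x y) = pmf \<nu> x" if "x \<in> ?V" for x
    proof -
      have "(\<Sum>y\<in>?V. t x y) = (\<Sum>y\<in>?V. m x y) + s x"
        using that fin by (simp add: t_def sum.distrib)
      also have "\<dots> = (\<Sum>y\<in>?V. pmf \<nu> x * pmf \<mu> y)"
        unfolding s_def sum.distrib[symmetric]
      proof (rule sum.cong[OF refl])
        fix y
        have "m x y + pmf \<mu> x * pmf \<mu> y * min (f x) (f y) = (pmf \<mu> x * f x) * pmf \<mu> y"
          by (auto simp: m_def max_def min_def algebra_simps)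
        then show "m x y + pmf \<mu> x * pmf \<mu> y * min (f x) (f y) = pmf \<nu> x * pmf \<mu> y"
          by (simp add: \<mu>f)
      qed
      also have "\<dots> = pmf \<nu> x"
        by (simp add: sum_distrib_left[symmetric] sum\<mu>)
      finally show ?thesis .
    qed
    show "(\<Sum>x\<in>?V. t x y) = pmf \<mu> y" if "y \<in> ?V" for y
    proof -
      have "(\<Sum>x\<in>?V. t x y) = (\<Sum>x\<in>?V. m x y) + s y"
        using that fin by (simp add: t_def sum.distrib)
      also have "\<dots> = (\<Sum>x\<in>?V. pmf \<mu> y * pmf \<nu> x)"
        unfolding s_def sum.distrib[symmetric]
      proof (rule sum.cong[OF refl])
        fix x
        have "m x y + pmf \<mu> y * pmf \<mu> x * min (f y) (f x) = pmf \<mu> y * (pmf \<mu> x * f x)"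
          by (auto simp: m_def max_def min_def algebra_simps)
        then show "m x y + pmf \<mu> y * pmf \<mu> x * min (f y) (f x) = pmf \<mu> y * pmf \<nu> x"
          by (simp add: \<mu>f)
      qed
      also have "\<dots> = pmf \<mu> y"
        by (simp add: sum_distrib_left[symmetric] sum\<nu>)
      finally show ?thesis .
    qed
  qed (rule that)
  then show thesis
    using that by (simp add: t_def m_def)
qed

section \<open>Transport cost and the variation of the root of the density\<close>

lemma W1_bounds:
  assumes nonneg: "\<And>x y. x \<in> pverts G \<Longrightarrow> y \<in> pverts G \<Longrightarrow> 0 \<le> \<rho> x y"
    and \<pi>: "\<pi> \<in> couplings \<nu> \<mu>"
  shows "0 \<le> W1 G \<rho> \<nu> \<mu>"
    and "W1 G \<rho> \<nu> \<mu> \<le> (\<Sum>x\<in>pverts G. \<Sum>y\<in>pverts G. \<rho> x y * pmf \<pi> (x, y))"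
proof -
  have cost: "0 \<le> (\<Sum>x\<in>pverts G. \<Sum>y\<in>pverts G. \<rho> x y * pmf \<pi>' (x, y))" for \<pi>' :: "('a \<times> 'a) pmf"
    by (intro sum_nonneg mult_nonneg_nonneg) (auto simp: nonneg)
  show "0 \<le> W1 G \<rho> \<nu> \<mu>"
    unfolding W1_def by (rule cINF_greatest) (use \<pi> cost in auto)
  show "W1 G \<rho> \<nu> \<mu> \<le> (\<Sum>x\<in>pverts G. \<Sum>y\<in>pverts G. \<rho> x y * pmf \<pi> (x, y))"
    unfolding W1_def by (rule cINF_lower[OF _ \<pi>]) (use cost in \<open>auto intro!: bdd_belowI2\<close>)
qed

lemma W1_sq_le_variation:
  assumes fin: "finite (pverts G)" and metric: "Metric_space (pverts G) \<rho>"
    and supp: "set_pmf \<mu> = pverts G" and ac: "set_pmf \<nu> \<subseteq> pverts G"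
  defines "h \<equiv> sqrt_density \<nu> \<mu>"
  shows "(W1 G \<rho> \<nu> \<mu>)\<^sup>2 \<le>
    (\<Sum>x\<in>pverts G. \<Sum>y\<in>pverts G. (\<rho> x y)\<^sup>2 * (h y - h x)\<^sup>2 * pmf \<mu> x * pmf \<mu> y)"
proof -
  interpret M: Metric_space "pverts G" \<rho> by (rule metric)
  let ?V = "pverts G"
  define f where "f x = pmf \<nu> x / pmf \<mu> x" for x
  have h_nonneg: "0 \<le> h x" and h_sq: "(h x)\<^sup>2 = f x" for x
    by (simp_all add: h_def sqrt_density_def f_def)
  have \<mu>f: "pmf \<mu> x * f x = pmf \<nu> x" for x
    using ac unfolding supp[symmetric] by (cases "x \<in> set_pmf \<mu>") (auto simp: f_def set_pmf_eq)
  have sum\<mu>: "(\<Sum>x\<in>?V. pmf \<mu> x) = 1" and sum\<nu>: "(\<Sum>x\<in>?V. pmf \<nu> x) = 1"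
    using sum_pmf_eq_1[OF fin ac] sum_pmf_eq_1[OF fin, of \<mu>] supp by auto
  obtain \<pi> where \<pi>: "\<pi> \<in> couplings \<nu> \<mu>"
    and off: "\<And>x y. x \<noteq> y \<Longrightarrow> pmf \<pi> (x, y) = pmf \<mu> x * pmf \<mu> y * max 0 (f x - f y)"
    unfolding f_def using excess_coupling[of \<mu> \<nu>] fin supp ac by metis
  define C where "C = (\<Sum>x\<in>?V. \<Sum>y\<in>?V. \<rho> x y * pmf \<pi> (x, y))"
  have C1: "C = (\<Sum>x\<in>?V. \<Sum>y\<in>?V. \<rho> x y * (pmf \<mu> x * pmf \<mu> y * max 0 (f x - f y)))"
    unfolding C_def
  proof (intro sum.cong refl)
    fix x y assume "x \<in> ?V" "y \<in> ?V"
    then show "\<rho> x y * pmf \<pi> (x, y) = \<rho> x y * (pmf \<mu> x * pmf \<mu> y * max 0 (f x - f y))"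
      by (cases "x = y") (auto simp: off)
  qed
  \<comment> \<open>The plan is one-sided; by symmetry of \<open>\<rho>\<close> its cost equals that of the reversed plan, and adding
      the two turns positive parts into absolute values.\<close>
  have C2: "C = (\<Sum>x\<in>?V. \<Sum>y\<in>?V. \<rho> x y * (pmf \<mu> x * pmf \<mu> y * max 0 (f y - f x)))"
    unfolding C1 by (subst sum.swap) (simp add: M.commute mult.commute)
  \<comment> \<open>The factors for Cauchy-Schwarz come from \<open>f y - f x = (h y - h x) (h y + h x)\<close>, with the
      weight \<open>\<mu>(x) \<mu>(y)\<close> split evenly.\<close>
  define a where "a = (\<lambda>(x, y). \<rho> x y * \<bar>h y - h x\<bar> * sqrt (pmf \<mu> x * pmf \<mu> y))"
  define b where "b = (\<lambda>(x, y). (h x + h y) * sqrt (pmf \<mu> x * pmf \<mu> y))"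
  have "2 * C = (\<Sum>x\<in>?V. \<Sum>y\<in>?V. \<rho> x y * (pmf \<mu> x * pmf \<mu> y * \<bar>f y - f x\<bar>))"
    unfolding mult_2 by (subst (1) C1, subst C2)
      (auto simp: sum.distrib[symmetric] max_def algebra_simps intro!: sum.cong)
  also have "\<dots> = (\<Sum>x\<in>?V. \<Sum>y\<in>?V. a (x, y) * b (x, y))"
  proof (intro sum.cong refl)
    fix x y
    have "\<bar>f y - f x\<bar> = \<bar>(h y - h x) * (h x + h y)\<bar>"
      by (simp add: h_sq[symmetric] power2_eq_square algebra_simps)
    also have "\<dots> = \<bar>h y - h x\<bar> * (h x + h y)"
      by (simp add: abs_mult h_nonneg)
    finally have *: "\<bar>f y - f x\<bar> = \<bar>h y - h x\<bar> * (h x + h y)" .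
    have "a (x, y) * b (x, y) =
        \<rho> x y * \<bar>h y - h x\<bar> * (h x + h y) * (sqrt (pmf \<mu> x * pmf \<mu> y) * sqrt (pmf \<mu> x * pmf \<mu> y))"
      by (simp add: a_def b_def mult_ac)
    then show "\<rho> x y * (pmf \<mu> x * pmf \<mu> y * \<bar>f y - f x\<bar>) = a (x, y) * b (x, y)"
      by (simp add: * mult_ac)
  qed
  also have "\<dots> = (\<Sum>p\<in>?V \<times> ?V. a p * b p)"
    by (simp add: sum.cartesian_product)
  finally have "(2 * C)\<^sup>2 \<le> (\<Sum>p\<in>?V \<times> ?V. (a p)\<^sup>2) * (\<Sum>p\<in>?V \<times> ?V. (b p)\<^sup>2)"
    using Cauchy_Schwarz_ineq_sum[of a b] by simp
  also have "\<dots> \<le> (\<Sum>p\<in>?V \<times> ?V. (a p)\<^sup>2) * 4"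
  proof (rule mult_left_mono)
    have "(\<Sum>p\<in>?V \<times> ?V. (b p)\<^sup>2) = (\<Sum>x\<in>?V. \<Sum>y\<in>?V. (b (x, y))\<^sup>2)"
      by (simp add: sum.cartesian_product)
    also have "\<dots> \<le> (\<Sum>x\<in>?V. \<Sum>y\<in>?V. 2 * (pmf \<nu> x * pmf \<mu> y) + 2 * (pmf \<mu> x * pmf \<nu> y))"
    proof (intro sum_mono)
      fix x y
      have "(h x + h y)\<^sup>2 \<le> 2 * f x + 2 * f y"
        using sum_squares_bound[of "h x" "h y"] by (simp add: h_sq[symmetric] power2_sum)
      then have "(h x + h y)\<^sup>2 * (pmf \<mu> x * pmf \<mu> y) \<le> (2 * f x + 2 * f y) * (pmf \<mu> x * pmf \<mu> y)"
        by (rule mult_right_mono) simp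
      also have "\<dots> = 2 * ((pmf \<mu> x * f x) * pmf \<mu> y) + 2 * (pmf \<mu> x * (pmf \<mu> y * f y))"
        by (simp add: algebra_simps)
      finally show "(b (x, y))\<^sup>2 \<le> 2 * (pmf \<nu> x * pmf \<mu> y) + 2 * (pmf \<mu> x * pmf \<nu> y)"
        by (simp add: b_def power_mult_distrib \<mu>f)
    qed
    also have "\<dots> = 4"
      by (simp add: sum.distrib sum_distrib_left[symmetric] sum_distrib_right[symmetric] sum\<mu> sum\<nu>)
    finally show "(\<Sum>p\<in>?V \<times> ?V. (b p)\<^sup>2) \<le> 4" .
  qed (simp add: sum_nonneg)
  finally have "C\<^sup>2 \<le> (\<Sum>p\<in>?V \<times> ?V. (a p)\<^sup>2)"
    by (simp add: power_mult_distrib)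
  also have "\<dots> = (\<Sum>x\<in>?V. \<Sum>y\<in>?V. (a (x, y))\<^sup>2)"
    by (simp add: sum.cartesian_product)
  also have "\<dots> = (\<Sum>x\<in>?V. \<Sum>y\<in>?V. (\<rho> x y)\<^sup>2 * (h y - h x)\<^sup>2 * pmf \<mu> x * pmf \<mu> y)"
    by (simp add: a_def power_mult_distrib mult_ac)
  finally have "C\<^sup>2 \<le> \<dots>" .
  moreover have "(W1 G \<rho> \<nu> \<mu>)\<^sup>2 \<le> C\<^sup>2"
    using W1_bounds[of G \<rho>, OF _ \<pi>] by (intro power_mono) (auto simp: C_def)
  ultimately show ?thesis
    by linarith
qed

section \<open>Variation along a path\<close>

context pair_wf_digraph
begin

lemma diff_along_awalk:
  "awalk x p y \<Longrightarrow> h y - h x = (\<Sum>e\<leftarrow>p. diff_along e h)"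
proof (induction p arbitrary: x)
  case (Cons e p)
  then have "x = fst e" "h y - h (snd e) = (\<Sum>e\<leftarrow>p. diff_along e h)"
    by (auto simp: awalk_Cons_iff)
  then show ?case
    by (simp add: diff_along_def)
qed (simp add: awalk_simps)

text \<open>
  Cauchy-Schwarz applied to \<open>D\<^sub>e h = sqrt (w e) \<cdot> (D\<^sub>e h / sqrt (w e))\<close>. Since the path visits no
  vertex twice, it repeats no edge, so sums over the edge list and over the edge set agree.
\<close>

lemma diff_sq_le_path:
  fixes w :: "'a \<times> 'a \<Rightarrow> real"
  assumes p: "apath x p y" and w: "\<And>e. e \<in> parcs G \<Longrightarrow> 0 < w e"
  shows "(h y - h x)\<^sup>2 \<le> path_length w p * (\<Sum>e\<in>set p. (diff_along e h)\<^sup>2 / w e)"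
proof -
  have walk: "awalk x p y" and "distinct p"
    using p distinct_verts_imp_distinct by (auto simp: apath_def)
  have pos: "0 < w e" if "e \<in> set p" for e
    using walk that by (auto simp: awalk_def intro!: w)
  have "h y - h x = (\<Sum>e\<in>set p. diff_along e h)"
    using diff_along_awalk[OF walk] \<open>distinct p\<close> by (simp add: sum_list_distinct_conv_sum_set)
  also have "\<dots> = (\<Sum>e\<in>set p. sqrt (w e) * (diff_along e h / sqrt (w e)))"
    using pos by (intro sum.cong) (auto simp: less_imp_neq[symmetric])
  also have "\<dots>\<^sup>2 \<le> (\<Sum>e\<in>set p. (sqrt (w e))\<^sup>2) * (\<Sum>e\<in>set p. (diff_along e h / sqrt (w e))\<^sup>2)"
    by (rule Cauchy_Schwarz_ineq_sum)
  also have "(\<Sum>e\<in>set p. (sqrt (w e))\<^sup>2) = path_length w p"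
    unfolding path_length_def using pos by (intro sum.cong) (auto simp: less_imp_le)
  also have "(\<Sum>e\<in>set p. (diff_along e h / sqrt (w e))\<^sup>2) = (\<Sum>e\<in>set p. (diff_along e h)\<^sup>2 / w e)"
    using pos by (intro sum.cong) (auto simp: power_divide less_imp_le)
  finally show ?thesis .
qed

end

section \<open>Positivity of the measure and of the conductances\<close>

text \<open>
  Detailed balance carries positivity of \<open>\<mu>\<close> across each edge, and connectedness carries it from
  one charged vertex to all of them. Consequently every \<open>\<nu>\<close> on the vertices has a density, and
  \<open>Q\<close> is positive on the edges.
\<close>

lemma full_support:
  assumes graph: "pair_graph G" and conn: "Digraph_Component.connected (with_proj G)"
    and rates: "jump_rates G q" and supp: "set_pmf \<mu> \<subseteq> pverts G"
    and reversible: "detailed_balance G q \<mu>"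
  shows "set_pmf \<mu> = pverts G"
proof (intro equalityI supp subsetI)
  interpret pair_graph G by (rule graph)
  fix y assume y: "y \<in> pverts G"
  obtain x where x: "x \<in> set_pmf \<mu>"
    using set_pmf_not_empty[of \<mu>] by auto
  have edge: "b \<in> set_pmf \<mu>" if e: "(a, b) \<in> parcs G" and a: "a \<in> set_pmf \<mu>" for a b
  proof -
    have "0 < q a b"
      using rates e in_arcsD1[OF e] in_arcsD2[OF e] by (auto simp: jump_rates_def)
    then have "0 < pmf \<mu> a * q a b"
      using a by (simp add: pmf_positive)
    also have "pmf \<mu> a * q a b = pmf \<mu> b * q b a"
      using reversible e by (auto simp: detailed_balance_def)
    finally show ?thesis
      by (auto simp: set_pmf_eq)
  qed
  have "x \<rightarrow>\<^sup>*\<^bsub>with_proj G\<^esub> y"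
    using conn x y supp reachable_mk_symmetric_eq[OF pair_sym_arcs]
    by (auto simp: connected_def strongly_connected_def)
  then show "y \<in> set_pmf \<mu>"
  proof (induction rule: reachable_induct)
    case base
    show ?case by (rule x)
  next
    case (step a b)
    then show ?case
      using edge by simp
  qed
qed

context pair_graph
begin

lemma conductance_pos:
  assumes "jump_rates G q" "set_pmf \<mu> = pverts G" "e \<in> parcs G"
  shows "0 < conductance q \<mu> e"
proof -
  have "fst e \<in> pverts G" "snd e \<in> pverts G"
    using assms(3) by (auto intro: arc_fst_in_verts arc_snd_in_verts)
  then have "0 < pmf \<mu> (fst e)" "0 < q (fst e) (snd e)"
    using assms by (auto simp: jump_rates_def intro: pmf_positive)
  then show ?thesis
    by (simp add: conductance_def)
qed

end

section \<open>Averaging over the random paths\<close>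

context pair_graph
begin

lemma edge_load_le_K_len:
  "e \<in> parcs G \<Longrightarrow> edge_load G q \<mu> \<rho> P \<gamma> w e \<le> K_len G q \<mu> \<rho> P \<gamma> w"
  by (auto simp: K_len_def pair_finite_arcs)

lemma random_paths_edges:
  assumes "random_paths G P \<gamma>" "x \<in> pverts G" "y \<in> pverts G" "\<omega> \<in> space P"
  shows "set (\<gamma> x y \<omega>) \<subseteq> parcs G"
proof (cases "x = y")
  case True
  then show ?thesis
    using assms by (simp add: random_paths_def)
next
  case False
  then have "apath x (\<gamma> x y \<omega>) y"
    using assms by (simp add: random_paths_def)
  then show ?thesis
    by (simp add: apath_def awalk_def)
qed

lemma path_length_bounds:
  assumes "w \<in> length_functions G" "set p \<subseteq> parcs G"
  shows "0 \<le> path_length w p" "path_length w p \<le> (\<Sum>e\<in>parcs G. w e)"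
proof -
  have w: "0 \<le> w e" if "e \<in> parcs G" for e
    using assms(1) that by (force simp: length_functions_def)
  show "0 \<le> path_length w p"
    unfolding path_length_def using assms(2) w by (intro sum_nonneg) auto
  show "path_length w p \<le> (\<Sum>e\<in>parcs G. w e)"
    unfolding path_length_def using assms(2) w by (intro sum_mono2 pair_finite_arcs) auto
qed

lemma K_len_nonneg:
  assumes rates: "jump_rates G q" and supp: "set_pmf \<mu> = pverts G"
    and paths: "random_paths G P \<gamma>" and w: "w \<in> length_functions G"
  shows "0 \<le> K_len G q \<mu> \<rho> P \<gamma> w"
proof (cases "parcs G = {}")
  case False
  then obtain e where e: "e \<in> parcs G"
    by auto
  have "0 < w e"
    using w e by (force simp: length_functions_def)
  moreover have "0 \<le> (\<Sum>x\<in>pverts G. \<Sum>y\<in>pverts G. prob_space.expectation P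
      (\<lambda>\<omega>. indicator (set (\<gamma> x y \<omega>)) e * (\<rho> x y)\<^sup>2 * path_length w (\<gamma> x y \<omega>)
             * pmf \<mu> x * pmf \<mu> y))"
    using path_length_bounds(1)[OF w random_paths_edges[OF paths]]
    by (intro sum_nonneg integral_nonneg) auto
  ultimately have "0 \<le> edge_load G q \<mu> \<rho> P \<gamma> w e"
    using conductance_pos[OF rates supp e] unfolding edge_load_def
    by (intro mult_nonneg_nonneg) auto
  then show ?thesis
    using edge_load_le_K_len[OF e, of q \<mu> \<rho> P \<gamma> w] by linarith
qed (simp add: K_len_def)

text \<open>
  This is a weighted Poincare inequality for an arbitrary function \<open>h\<close>. The path bound holds for
  each outcome; it survives the expectation because, there being finitely many edges, the lengths
  of circle-free paths are uniformly bounded, which makes the integrands integrable.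
\<close>

lemma variation_le_K_len:
  assumes rates: "jump_rates G q" and supp: "set_pmf \<mu> = pverts G"
    and paths: "random_paths G P \<gamma>" and w: "w \<in> length_functions G"
  shows "(\<Sum>x\<in>pverts G. \<Sum>y\<in>pverts G. (\<rho> x y)\<^sup>2 * (h y - h x)\<^sup>2 * pmf \<mu> x * pmf \<mu> y)
    \<le> K_len G q \<mu> \<rho> P \<gamma> w * (\<Sum>e\<in>parcs G. (diff_along e h)\<^sup>2 * conductance q \<mu> e)"
proof -
  let ?V = "pverts G" and ?E = "parcs G" and ?K = "K_len G q \<mu> \<rho> P \<gamma> w"
  interpret P: prob_space P
    using paths by (simp add: random_paths_def)
  have w_pos: "0 < w e" if "e \<in> ?E" for e
    using w that by (force simp: length_functions_def)
  define X where "X x y e \<omega> = indicator (set (\<gamma> x y \<omega>)) e * (\<rho> x y)\<^sup>2 *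
    path_length w (\<gamma> x y \<omega>) * pmf \<mu> x * pmf \<mu> y" for x y e \<omega>
  have integrable: "integrable P (X x y e)" if x: "x \<in> ?V" and y: "y \<in> ?V" for x y e
  proof (rule P.integrable_const_bound)
    show "AE \<omega> in P. norm (X x y e \<omega>) \<le> (\<rho> x y)\<^sup>2 * (\<Sum>e\<in>?E. w e) * pmf \<mu> x * pmf \<mu> y"
    proof (rule AE_I2)
      fix \<omega> assume "\<omega> \<in> space P"
      note l = path_length_bounds[OF w random_paths_edges[OF paths x y this]]
      have "norm (X x y e \<omega>) =
          indicator (set (\<gamma> x y \<omega>)) e * ((\<rho> x y)\<^sup>2 * path_length w (\<gamma> x y \<omega>) * pmf \<mu> x * pmf \<mu> y)"
        using l by (simp add: X_def abs_mult mult_ac)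
      also have "\<dots> \<le> 1 * ((\<rho> x y)\<^sup>2 * (\<Sum>e\<in>?E. w e) * pmf \<mu> x * pmf \<mu> y)"
        using l by (intro mult_mono mult_right_mono mult_left_mono) (auto simp: indicator_def)
      finally show "norm (X x y e \<omega>) \<le> (\<rho> x y)\<^sup>2 * (\<Sum>e\<in>?E. w e) * pmf \<mu> x * pmf \<mu> y"
        by simp
    qed
    have "\<gamma> x y \<in> measurable P (count_space UNIV)"
      using paths x y by (simp add: random_paths_def)
    moreover have "(\<lambda>p. indicator (set p) e * (\<rho> x y)\<^sup>2 * path_length w p * pmf \<mu> x * pmf \<mu> y)
        \<in> borel_measurable (count_space UNIV)"
      by simp
    ultimately show "X x y e \<in> borel_measurable P"
      unfolding X_def by (rule measurable_compose)
  qed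
  have pointwise: "(\<rho> x y)\<^sup>2 * (h y - h x)\<^sup>2 * pmf \<mu> x * pmf \<mu> y
      \<le> (\<Sum>e\<in>?E. (diff_along e h)\<^sup>2 / w e * X x y e \<omega>)"
    if x: "x \<in> ?V" and y: "y \<in> ?V" and \<omega>: "\<omega> \<in> space P" for x y \<omega>
  proof (cases "x = y")
    case True
    then have "\<gamma> x y \<omega> = []"
      using paths x y \<omega> by (simp add: random_paths_def)
    then show ?thesis
      using True by (simp add: X_def path_length_def)
  next
    case False
    let ?p = "\<gamma> x y \<omega>" and ?c = "(\<rho> x y)\<^sup>2 * pmf \<mu> x * pmf \<mu> y"
    have p: "apath x ?p y"
      using paths x y \<omega> False by (simp add: random_paths_def)
    have "?c * (h y - h x)\<^sup>2 \<le> ?c * (path_length w ?p * (\<Sum>e\<in>set ?p. (diff_along e h)\<^sup>2 / w e))"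
      using diff_sq_le_path[OF p w_pos] by (intro mult_left_mono) auto
    also have "(\<Sum>e\<in>set ?p. (diff_along e h)\<^sup>2 / w e)
        = (\<Sum>e\<in>?E. indicator (set ?p) e * ((diff_along e h)\<^sup>2 / w e))"
      using random_paths_edges[OF paths x y \<omega>] pair_finite_arcs
      by (intro sum.mono_neutral_cong_left) auto
    also have "?c * (path_length w ?p * \<dots>) = (\<Sum>e\<in>?E. (diff_along e h)\<^sup>2 / w e * X x y e \<omega>)"
      unfolding sum_distrib_left by (intro sum.cong) (auto simp: X_def)
    finally show ?thesis
      by (simp add: mult_ac)
  qed
  have mean: "(\<rho> x y)\<^sup>2 * (h y - h x)\<^sup>2 * pmf \<mu> x * pmf \<mu> y
      \<le> (\<Sum>e\<in>?E. (diff_along e h)\<^sup>2 / w e * P.expectation (X x y e))"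
    if x: "x \<in> ?V" and y: "y \<in> ?V" for x y
  proof -
    have "(\<rho> x y)\<^sup>2 * (h y - h x)\<^sup>2 * pmf \<mu> x * pmf \<mu> y
        = P.expectation (\<lambda>\<omega>. (\<rho> x y)\<^sup>2 * (h y - h x)\<^sup>2 * pmf \<mu> x * pmf \<mu> y)"
      by (simp add: P.prob_space)
    also have "\<dots> \<le> P.expectation (\<lambda>\<omega>. \<Sum>e\<in>?E. (diff_along e h)\<^sup>2 / w e * X x y e \<omega>)"
      by (intro integral_mono Bochner_Integration.integrable_sum integrable_mult_right
          integrable pointwise x y) simp
    also have "\<dots> = (\<Sum>e\<in>?E. (diff_along e h)\<^sup>2 / w e * P.expectation (X x y e))"
      by (simp add: Bochner_Integration.integral_sum integrable x y)
    finally show ?thesis .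
  qed
  have "(\<Sum>x\<in>?V. \<Sum>y\<in>?V. (\<rho> x y)\<^sup>2 * (h y - h x)\<^sup>2 * pmf \<mu> x * pmf \<mu> y)
      \<le> (\<Sum>x\<in>?V. \<Sum>y\<in>?V. \<Sum>e\<in>?E. (diff_along e h)\<^sup>2 / w e * P.expectation (X x y e))"
    by (intro sum_mono mean)
  also have "\<dots> = (\<Sum>x\<in>?V. \<Sum>e\<in>?E. \<Sum>y\<in>?V. (diff_along e h)\<^sup>2 / w e * P.expectation (X x y e))"
    by (intro sum.cong refl) (rule sum.swap)
  also have "\<dots> = (\<Sum>e\<in>?E. \<Sum>x\<in>?V. \<Sum>y\<in>?V. (diff_along e h)\<^sup>2 / w e * P.expectation (X x y e))"
    by (rule sum.swap)
  also have "\<dots> = (\<Sum>e\<in>?E. (diff_along e h)\<^sup>2 / w e *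
      (\<Sum>x\<in>?V. \<Sum>y\<in>?V. P.expectation (X x y e)))"
    by (simp add: sum_distrib_left)
  also have "\<dots> \<le> (\<Sum>e\<in>?E. ?K * ((diff_along e h)\<^sup>2 * conductance q \<mu> e))"
  proof (rule sum_mono)
    fix e assume e: "e \<in> ?E"
    let ?S = "\<Sum>x\<in>?V. \<Sum>y\<in>?V. P.expectation (X x y e)"
    have "1 / (conductance q \<mu> e * w e) * ?S \<le> ?K"
      using edge_load_le_K_len[OF e] by (simp add: edge_load_def X_def[abs_def])
    then have "?S \<le> ?K * (conductance q \<mu> e * w e)"
      using conductance_pos[OF rates supp e] w_pos[OF e] by (simp add: pos_divide_le_eq)
    then have "(diff_along e h)\<^sup>2 / w e * ?S
        \<le> (diff_along e h)\<^sup>2 / w e * (?K * (conductance q \<mu> e * w e))"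
      using w_pos[OF e] by (intro mult_left_mono) auto
    also have "\<dots> = ?K * ((diff_along e h)\<^sup>2 * conductance q \<mu> e)"
      using w_pos[OF e] by simp
    finally show "(diff_along e h)\<^sup>2 / w e * ?S
        \<le> ?K * ((diff_along e h)\<^sup>2 * conductance q \<mu> e)" .
  qed
  finally show ?thesis
    by (simp add: sum_distrib_left)
qed

lemma transport_information_K_len:
  assumes rates: "jump_rates G q" and supp: "set_pmf \<mu> = pverts G"
    and metric: "Metric_space (pverts G) \<rho>"
    and paths: "random_paths G P \<gamma>" and w: "w \<in> length_functions G"
  shows "transport_information G q \<mu> \<rho> (K_len G q \<mu> \<rho> P \<gamma> w)"
  unfolding transport_information_def
proof (intro allI impI)
  fix \<nu> assume ac: "set_pmf \<nu> \<subseteq> pverts G"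
  show "(W1 G \<rho> \<nu> \<mu>)\<^sup>2 \<le> 2 * K_len G q \<mu> \<rho> P \<gamma> w * information G q \<nu> \<mu>"
    using order_trans[OF W1_sq_le_variation[OF pair_finite_verts metric supp ac]
        variation_le_K_len[OF rates supp paths w]]
    by (simp add: information_def)
qed

lemma information_nonneg:
  assumes "jump_rates G q" "set_pmf \<mu> = pverts G"
  shows "0 \<le> information G q \<nu> \<mu>"
  unfolding information_def using conductance_pos[OF assms]
  by (auto intro!: sum_nonneg mult_nonneg_nonneg simp: less_imp_le)

end

section \<open>The best constant\<close>

text \<open>
  The inequality passes to the infimum of the admissible constants. If \<open>I(\<nu>|\<mu>) > 0\<close>, then
  \<open>W\<^sub>1\<^sup>2 / (2 I)\<close> is a lower bound of the admissible constants; if \<open>I(\<nu>|\<mu>) = 0\<close>, one admissible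
  constant already forces \<open>W\<^sub>1 = 0\<close>.
\<close>

lemma transport_information_c_G:
  assumes I: "\<And>\<nu>. 0 \<le> information G q \<nu> \<mu>"
    and c0: "0 \<le> c0" "transport_information G q \<mu> \<rho> c0"
  shows "transport_information G q \<mu> \<rho> (c_G G q \<mu> \<rho>)"
  unfolding transport_information_def
proof (intro allI impI)
  fix \<nu> assume \<nu>: "set_pmf \<nu> \<subseteq> pverts G"
  let ?W = "(W1 G \<rho> \<nu> \<mu>)\<^sup>2" and ?I = "information G q \<nu> \<mu>"
  have bound: "?W \<le> 2 * c * ?I" if "transport_information G q \<mu> \<rho> c" for c
    using that \<nu> by (simp add: transport_information_def)
  show "?W \<le> 2 * c_G G q \<mu> \<rho> * ?I"
  proof (cases "?I = 0")
    case True
    then show ?thesis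
      using bound[OF c0(2)] by simp
  next
    case False
    then have pos: "0 < ?I"
      using I[of \<nu>] by simp
    have "?W / (2 * ?I) \<le> c_G G q \<mu> \<rho>"
      unfolding c_G_def
    proof (rule cInf_greatest)
      fix c assume "c \<in> {c. 0 \<le> c \<and> transport_information G q \<mu> \<rho> c}"
      then show "?W / (2 * ?I) \<le> c"
        using bound[of c] pos by (simp add: pos_divide_le_eq mult_ac)
    qed (use c0 in auto)
    then show ?thesis
      using pos by (simp add: pos_divide_le_eq mult_ac)
  qed
qed

lemma c_G_le:
  "0 \<le> c \<Longrightarrow> transport_information G q \<mu> \<rho> c \<Longrightarrow> c_G G q \<mu> \<rho> \<le> c"
  unfolding c_G_def by (rule cInf_lower) (auto intro: bdd_belowI[of _ 0])

theorem theorem3p1: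
  fixes G :: "'a pair_pre_digraph"
    and q :: "'a \<Rightarrow> 'a \<Rightarrow> real"
    and \<mu> :: "'a pmf"
    and \<rho> :: "'a \<Rightarrow> 'a \<Rightarrow> real"
    and P :: "'w measure"
    and \<gamma> :: "'a \<Rightarrow> 'a \<Rightarrow> 'w \<Rightarrow> ('a \<times> 'a) awalk"
  assumes graph: "pair_graph G"
    and conn: "Digraph_Component.connected (with_proj G)"
    and rates: "jump_rates G q"
    and supp: "set_pmf \<mu> \<subseteq> pverts G"
    and reversible: "detailed_balance G q \<mu>"
    and metric: "Metric_space (pverts G) \<rho>"
    and paths: "random_paths G P \<gamma>"
  shows "transport_information G q \<mu> \<rho> (c_G G q \<mu> \<rho>)
       \<and> c_G G q \<mu> \<rho> \<le> K_inf G q \<mu> \<rho> P \<gamma>"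
proof
  interpret pair_graph G by (rule graph)
  have full: "set_pmf \<mu> = pverts G"
    by (rule full_support[OF graph conn rates supp reversible])
  note K = K_len_nonneg[OF rates full paths, of _ \<rho>]
    transport_information_K_len[OF rates full metric paths]
  have unit: "(\<lambda>_. 1) \<in> length_functions G"
    by (auto simp: length_functions_def)
  show "transport_information G q \<mu> \<rho> (c_G G q \<mu> \<rho>)"
    using information_nonneg[OF rates full] K[OF unit] by (rule transport_information_c_G)
  show "c_G G q \<mu> \<rho> \<le> K_inf G q \<mu> \<rho> P \<gamma>"
    unfolding K_inf_def using unit by (intro cINF_greatest c_G_le K) auto
qed

end
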